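(* Let $p\ge1$, let $\varphi:\mathbb{R}^n\times\mathbb{R}^{n_1}\times\dots\times\mathbb{R}^{n_p}\to\mathbb{R}^n$ be Lipschitz continuous in each of its arguments with constants $L_j$ ($j=0,\dots,p$), and let the solution maps $(\mathbf{x},\mathbf{u}_1,\dots,\mathbf{u}_{j-1})\mapsto\mathbf{u}_j$ be Lipschitz continuous with respect to each of their arguments with constants $K_{j,\ell}$ ($j=1,\dots,p$, $\ell=0,\dots,j-1$). Let $G(\mathbf{x})=\varphi(\mathbf{x},\mathbf{u}_1,\dots,\mathbf{u}_p)$. If multiple systems are approximated with a reduced-order model, $\mathbf{u}_i\approx\widehat{\mathbf{u}}_i$ for $i\in\mathcal{I}\subseteq\{1,\dots,p\}$, and $G_k$ denotes the resulting inexact operator, then $$\delta^k_{\mathcal{I},p}=\sum_{i\in\mathcal{I}}\delta^k_{i,p}$$ is an upper bound on the approximation error, i.e. the distance between the values of $G$ and of the inexact operator at the iterate $\mathbf{x}^{k-1}$ from which the $k$-th iterate is computed is at most $\delta^k_{\mathcal{I},p}$.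
   Context: For $i=1,\dots,p$, the vector $\mathbf{u}_i\in\mathbb{R}^{n_i}$ is the solution of a linear system whose data depend on $\mathbf{x}\in\mathbb{R}^n$ and on the previous solutions: $\mathbf{u}_i=A_i^{-1}F_i$, with $A_i=A_i(\mathbf{x},\mathbf{u}_1,\dots,\mathbf{u}_{i-1})\in\mathrm{GL}_{n_i}(\mathbb{R})$ and $F_i=F_i(\mathbf{x},\mathbf{u}_1,\dots,\mathbf{u}_{i-1})\in\mathbb{R}^{n_i}$. This defines the solution maps $(\mathbf{x},\mathbf{u}_1,\dots,\mathbf{u}_{i-1})\mapsto\mathbf{u}_i$. In $G(\mathbf{x})=\varphi(\mathbf{x},\mathbf{u}_1,\dots,\mathbf{u}_p)$ the $\mathbf{u}_i$ are computed recursively from $\mathbf{x}$. Norms are Euclidean, with the induced operator norm for matrices. "Lipschitz continuous in an argument with constant $c$" means $c$-Lipschitz in that argument when the others are held fixed, uniformly over the values of the others; $L_0$, $K_{j,0}$ refer to the argument $\mathbf{x}$, and $L_j$, $K_{j,\ell}$ ($j,\ell\ge1$) to $\mathbf{u}_j$, $\mathbf{u}_\ell$ respectively. $d_{i,j}$ is the set of strictly decreasing integer sequences $\sigma=(\sigma_1,\dots,\sigma_{|\sigma|})$ with $\sigma_1=j$ and $\sigma_{|\sigma|}=i$; $|\sigma|$ is the number of terms. Reduced-order model (ROM) approximation of system $i$ with data $\mu=(\mathbf{x},\mathbf{w}_1,\dots,\mathbf{w}_{i-1})$: given a reduced basis matrix $V\in\mathbb{R}^{n_i\times P}$ and mean snapshot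 $\overline{u}\in\mathbb{R}^{n_i}$ built from previous iterations (both depending on $i$), $\widehat{\mathbf{u}}_i(\mu)=V\alpha+\overline{u}$, where $\alpha\in\mathbb{R}^P$ solves $V^\top A_i(\mu)V\alpha=V^\top F_i(\mu)-V^\top A_i(\mu)\overline{u}$ (assumed solvable). The residual is $r_i(\mu,\widehat{\mathbf{u}})=F_i(\mu)-A_i(\mu)\widehat{\mathbf{u}}$. Inexact operator: its value at $\mathbf{x}$ is $\varphi(\mathbf{x},\mathbf{w}_1,\dots,\mathbf{w}_p)$, where recursively $\mathbf{w}_i=\widehat{\mathbf{u}}_i(\mathbf{x},\mathbf{w}_1,\dots,\mathbf{w}_{i-1})$ if $i\in\mathcal{I}$, and $\mathbf{w}_i=\mathbf{u}_i(\mathbf{x},\mathbf{w}_1,\dots,\mathbf{w}_{i-1})$ otherwise. The individual terms are $$\delta^{k}_{i,p}=\left(L_i+\sum_{j=i+1}^pL_j\sum_{\sigma\in d_{i,j}}\prod_{m=1}^{|\sigma|-1}K_{\sigma_m,\sigma_{m+1}}\right)\|A_i^{-1}(\mu_i^{k})\|\,\|r_i(\mu_i^{k},\widehat{\mathbf{u}}_i^{k})\|,$$ where the quantities are evaluated with the information actually computed at the current iteration: $\mu_i^{k}=(\mathbf{x}^{k-1},\mathbf{w}_1,\dots,\mathbf{w}_{i-1})$ with the $\mathbf{w}_j$ computed from $\mathbf{x}=\mathbf{x}^{k-1}$ (so $\mu_i^k$ may contain both exact and ROM solutions), and $\widehat{\mathbf{u}}_i^{k}=\widehat{\mathbf{u}}_i(\mu_i^k)=\mathbf{w}_i$.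 *)

theory Defs
  imports
    "HOL-Analysis.L2_Norm"
    "Jordan_Normal_Form.Gauss_Jordan_Elimination"
begin

definition vnorm :: "real vec \<Rightarrow> real" where
  "vnorm v = L2_set (\<lambda>i. v $ i) {..<dim_vec v}"

text \<open>As in the library's \<open>onorm\<close>, the quotient at \<open>v = 0\<close> is \<open>0 / 0 = 0\<close>.\<close>

definition opnorm :: "real mat \<Rightarrow> real" where
  "opnorm A = (SUP v\<in>carrier_vec (dim_col A). vnorm (A *\<^sub>v v) / vnorm v)"

definition minv :: "real mat \<Rightarrow> real mat" where
  "minv A = the (mat_inverse A)"

text \<open>
  The dimensions are given by \<open>N\<close>, with \<open>N 0\<close> the dimension \<open>n\<close> of \<open>x\<close> and \<open>N i\<close> the
  dimension \<open>n\<^sub>i\<close> of \<open>u\<^sub>i\<close> for \<open>i \<ge> 1\<close>.  An argument tuple \<open>(x, u\<^sub>1, \<dots>)\<close> is a list, whose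
  entry \<open>0\<close> is \<open>x\<close> and whose entry \<open>j \<ge> 1\<close> is \<open>u\<^sub>j\<close>.  So the data
  \<open>(x, u\<^sub>1, \<dots>, u\<^bsub>i-1\<^esub>)\<close> of system \<open>i\<close> belong to \<open>tuples N i\<close>, and the arguments of
  \<open>\<phi>\<close> to \<open>tuples N (Suc p)\<close>.
\<close>

definition tuples :: "(nat \<Rightarrow> nat) \<Rightarrow> nat \<Rightarrow> real vec list set" where
  "tuples N m = {\<mu>. length \<mu> = m \<and> (\<forall>l<m. \<mu> ! l \<in> carrier_vec (N l))}"

text \<open>
  \<open>c\<close>-Lipschitz in argument \<open>l\<close> with the others fixed.  The conjunct \<open>0 \<le> c\<close>, as in the
  library's \<open>lipschitz_on\<close>, only matters if \<open>N l = 0\<close>.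
\<close>

definition lipschitz_in_arg ::
    "(nat \<Rightarrow> nat) \<Rightarrow> nat \<Rightarrow> nat \<Rightarrow> real \<Rightarrow> (real vec list \<Rightarrow> real vec) \<Rightarrow> bool" where
  "lipschitz_in_arg N m l c f \<longleftrightarrow> 0 \<le> c \<and>
     (\<forall>\<mu>\<in>tuples N m. \<forall>v\<in>carrier_vec (N l).
        vnorm (f (\<mu>[l := v]) - f \<mu>) \<le> c * vnorm (v - \<mu> ! l))"

definition solution_map ::
    "(nat \<Rightarrow> real vec list \<Rightarrow> real mat) \<Rightarrow> (nat \<Rightarrow> real vec list \<Rightarrow> real vec)
     \<Rightarrow> nat \<Rightarrow> real vec list \<Rightarrow> real vec" where
  "solution_map A F i \<mu> = minv (A i \<mu>) *\<^sub>v F i \<mu>"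

text \<open>\<open>chain S x i\<close> is \<open>[x, w\<^sub>1, \<dots>, w\<^sub>i]\<close> with \<open>w\<^sub>j = S j [x, w\<^sub>1, \<dots>, w\<^bsub>j-1\<^esub>]\<close>.\<close>

primrec chain ::
    "(nat \<Rightarrow> real vec list \<Rightarrow> real vec) \<Rightarrow> real vec \<Rightarrow> nat \<Rightarrow> real vec list" where
  "chain S x 0 = [x]"
| "chain S x (Suc i) = chain S x i @ [S (Suc i) (chain S x i)]"

definition composed_op ::
    "(real vec list \<Rightarrow> real vec) \<Rightarrow> nat \<Rightarrow> (nat \<Rightarrow> real vec list \<Rightarrow> real vec)
     \<Rightarrow> real vec \<Rightarrow> real vec" where
  "composed_op \<phi> p S x = \<phi> (chain S x p)"

definition exact_op where
  "exact_op \<phi> p A F = composed_op \<phi> p (solution_map A F)"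

definition inexact_map ::
    "(nat \<Rightarrow> real vec list \<Rightarrow> real mat) \<Rightarrow> (nat \<Rightarrow> real vec list \<Rightarrow> real vec)
     \<Rightarrow> nat set \<Rightarrow> (nat \<Rightarrow> real vec list \<Rightarrow> real vec)
     \<Rightarrow> nat \<Rightarrow> real vec list \<Rightarrow> real vec" where
  "inexact_map A F I uhat i \<mu> = (if i \<in> I then uhat i \<mu> else solution_map A F i \<mu>)"

definition inexact_op where
  "inexact_op \<phi> p A F I uhat = composed_op \<phi> p (inexact_map A F I uhat)"

text \<open>The data \<open>(x, w\<^sub>1, \<dots>, w\<^bsub>i-1\<^esub>)\<close> of system \<open>i \<ge> 1\<close> computed in the inexact operator.\<close>

definition inexact_data where
  "inexact_data A F I uhat x i = chain (inexact_map A F I uhat) x (i - 1)"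

definition is_rom_solution ::
    "real mat \<Rightarrow> real vec \<Rightarrow> real mat \<Rightarrow> real vec \<Rightarrow> real vec \<Rightarrow> bool" where
  "is_rom_solution A F V ubar u \<longleftrightarrow>
     (\<exists>\<alpha>\<in>carrier_vec (dim_col V).
        (transpose_mat V * A * V) *\<^sub>v \<alpha>
          = transpose_mat V *\<^sub>v F - (transpose_mat V * A) *\<^sub>v ubar
        \<and> u = V *\<^sub>v \<alpha> + ubar)"

definition residual :: "real mat \<Rightarrow> real vec \<Rightarrow> real vec \<Rightarrow> real vec" where
  "residual A F u = F - A *\<^sub>v u"

definition dec_seqs :: "nat \<Rightarrow> nat \<Rightarrow> nat list set" where
  "dec_seqs i j = {\<sigma>. \<sigma> \<noteq> [] \<and> sorted_wrt (>) \<sigma> \<and> hd \<sigma> = j \<and> last \<sigma> = i}"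

definition delta ::
    "nat \<Rightarrow> (nat \<Rightarrow> real) \<Rightarrow> (nat \<Rightarrow> nat \<Rightarrow> real)
     \<Rightarrow> (nat \<Rightarrow> real vec list \<Rightarrow> real mat) \<Rightarrow> (nat \<Rightarrow> real vec list \<Rightarrow> real vec)
     \<Rightarrow> nat set \<Rightarrow> (nat \<Rightarrow> real vec list \<Rightarrow> real vec) \<Rightarrow> real vec \<Rightarrow> nat \<Rightarrow> real" where
  "delta p L K A F I uhat x i =
     (let \<mu> = inexact_data A F I uhat x i in
       (L i + (\<Sum>j = i+1..p. L j *
          (\<Sum>\<sigma>\<in>dec_seqs i j. \<Prod>m<length \<sigma> - 1. K (\<sigma> ! m) (\<sigma> ! Suc m))))
       * opnorm (minv (A i \<mu>)) * vnorm (residual (A i \<mu>) (F i \<mu>) (uhat i \<mu>)))"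

end

theory Submission
  imports Defs
begin

text \<open>
  Let \<open>u\<close> and \<open>w\<close> be the exact and the inexact chain of solutions starting from the same
  \<open>x\<close>, and let \<open>e j\<close> be the norm of \<open>u\<^sub>j - w\<^sub>j\<close>.  Inserting the \<^emph>\<open>exact\<close> solution map
  evaluated at the \<^emph>\<open>inexact\<close> data \<open>\<mu>\<^sub>j\<close> splits this error into two parts.  The local part
  \<open>A\<^sub>j\<inverse>F\<^sub>j - w\<^sub>j\<close> equals \<open>A\<^sub>j\<inverse>\<close> applied to the residual and so has norm at most \<open>a j\<close>, the
  product of the two norms in \<open>\<delta>\<^sub>j\<close> (or zero, if system \<open>j\<close> is solved exactly).  The
  propagated part is controlled by the Lipschitz constants, since the data can be exchanged
  one entry at a time (\<open>lipschitz_in_args\<close>).  Hence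
  \<open>e j \<le> a j + (\<Sum>l<j. K j l * e l)\<close>, and \<open>e 0 = 0\<close>.

  Unrolling this triangular recursion multiplies each \<open>a i\<close> by the sum, over all strictly
  decreasing sequences from \<open>j\<close> to \<open>i\<close>, of the products of the constants \<open>K\<close> along the
  sequence.  In matrix form these path weights \<open>W\<close> are the Neumann series of the strictly
  lower triangular matrix \<open>K\<close>, and all that is used about them is the identity
  \<open>W = 1 + K W\<close> (\<open>path_weight_rec\<close>), which comes from removing the first term of a sequence.
  By induction \<open>e \<le> W a\<close> (\<open>error_propagation\<close>).  The Lipschitz constants of \<open>\<phi>\<close> bound the
  distance of the values by \<open>\<Sum>j\<le>p. L j * e j\<close>; collecting the coefficient of each \<open>a i\<close>
  gives \<open>\<delta>\<^sub>i\<close>.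
\<close>

section \<open>Euclidean norm and operator norm\<close>

lemma vnorm_nonneg [simp]: "0 \<le> vnorm v"
  by (simp add: vnorm_def)

lemma vnorm_zero [simp]: "vnorm (0\<^sub>v n) = 0"
  by (simp add: vnorm_def L2_set_def)

lemma vnorm_add_le:
  assumes "u \<in> carrier_vec n" and "v \<in> carrier_vec n"
  shows "vnorm (u + v) \<le> vnorm u + vnorm v"
proof -
  have "vnorm (u + v) = L2_set (\<lambda>i. u $ i + v $ i) {..<n}"
    using assms unfolding vnorm_def by (intro L2_set_cong) auto
  also have "\<dots> \<le> L2_set (\<lambda>i. u $ i) {..<n} + L2_set (\<lambda>i. v $ i) {..<n}"
    by (rule L2_set_triangle_ineq)
  finally show ?thesis
    using assms by (simp add: vnorm_def)
qed

lemma vnorm_diff_triangle: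
  assumes "u \<in> carrier_vec n" and "v \<in> carrier_vec n" and "w \<in> carrier_vec n"
  shows "vnorm (u - w) \<le> vnorm (u - v) + vnorm (v - w)"
proof -
  have "u - w = (u - v) + (v - w)"
    using assms by (intro eq_vecI) auto
  then show ?thesis
    using vnorm_add_le[of "u - v" n "v - w"] assms by simp
qed

text \<open>
  The supremum defining \<open>opnorm\<close> is over an unbounded set of vectors, so it is only meaningful
  once the quotients are known to be bounded; the sum of the absolute values of all entries is
  a crude bound that suffices.
\<close>

lemma vnorm_mult_mat_vec_le_entries:
  assumes "v \<in> carrier_vec (dim_col B)"
  shows "vnorm (B *\<^sub>v v) \<le> (\<Sum>i<dim_row B. \<Sum>j<dim_col B. \<bar>B $$ (i, j)\<bar>) * vnorm v"
proof -
  have entry: "\<bar>v $ j\<bar> \<le> vnorm v" if "j < dim_col B" for j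
  proof -
    have "\<bar>v $ j\<bar> \<le> L2_set (\<lambda>i. \<bar>v $ i\<bar>) {..<dim_vec v}"
      using that assms by (intro member_le_L2_set) auto
    also have "\<dots> = vnorm v"
      by (simp add: vnorm_def L2_set_def)
    finally show ?thesis .
  qed
  have "vnorm (B *\<^sub>v v) \<le> (\<Sum>i<dim_row B. \<bar>(B *\<^sub>v v) $ i\<bar>)"
    unfolding vnorm_def dim_mult_mat_vec by (rule L2_set_le_sum_abs)
  also have "\<dots> \<le> (\<Sum>i<dim_row B. \<Sum>j<dim_col B. \<bar>B $$ (i, j)\<bar> * vnorm v)"
  proof (rule sum_mono)
    fix i assume i: "i \<in> {..<dim_row B}"
    have "(B *\<^sub>v v) $ i = (\<Sum>j<dim_col B. B $$ (i, j) * v $ j)"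
      using i assms by (simp add: scalar_prod_def atLeast0LessThan)
    then have "\<bar>(B *\<^sub>v v) $ i\<bar> \<le> (\<Sum>j<dim_col B. \<bar>B $$ (i, j)\<bar> * \<bar>v $ j\<bar>)"
      by (simp add: abs_mult[symmetric] sum_abs)
    also have "\<dots> \<le> (\<Sum>j<dim_col B. \<bar>B $$ (i, j)\<bar> * vnorm v)"
      by (intro sum_mono mult_left_mono entry) auto
    finally show "\<bar>(B *\<^sub>v v) $ i\<bar> \<le> (\<Sum>j<dim_col B. \<bar>B $$ (i, j)\<bar> * vnorm v)" .
  qed
  also have "\<dots> = (\<Sum>i<dim_row B. \<Sum>j<dim_col B. \<bar>B $$ (i, j)\<bar>) * vnorm v"
    by (simp add: sum_distrib_right)
  finally show ?thesis .
qed

lemma vnorm_mult_mat_vec_le: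
  assumes "v \<in> carrier_vec (dim_col B)"
  shows "vnorm (B *\<^sub>v v) \<le> opnorm B * vnorm v"
proof (cases "vnorm v = 0")
  case True
  then show ?thesis
    using vnorm_mult_mat_vec_le_entries[OF assms] by simp
next
  case False
  let ?c = "\<Sum>i<dim_row B. \<Sum>j<dim_col B. \<bar>B $$ (i, j)\<bar>"
  have "vnorm (B *\<^sub>v u) / vnorm u \<le> ?c" if "u \<in> carrier_vec (dim_col B)" for u
  proof (cases "vnorm u = 0")
    case True
    then show ?thesis by (simp add: sum_nonneg)
  next
    case False
    then have "0 < vnorm u" by (simp add: less_le)
    then show ?thesis
      using vnorm_mult_mat_vec_le_entries[OF that] by (simp add: pos_divide_le_eq)
  qed
  then have "bdd_above ((\<lambda>u. vnorm (B *\<^sub>v u) / vnorm u) ` carrier_vec (dim_col B))"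
    by (auto intro!: bdd_aboveI2)
  then have "vnorm (B *\<^sub>v v) / vnorm v \<le> opnorm B"
    unfolding opnorm_def using assms by (intro cSUP_upper)
  moreover have "0 < vnorm v"
    using False by (simp add: less_le)
  ultimately show ?thesis
    by (simp add: pos_divide_le_eq)
qed

section \<open>Residual bound\<close>

lemma minv_properties:
  assumes "A \<in> carrier_mat n n" and "invertible_mat A"
  shows "minv A \<in> carrier_mat n n" and "minv A * A = 1\<^sub>m n"
proof -
  obtain B where "A * B = 1\<^sub>m (dim_row A)" and "B * A = 1\<^sub>m (dim_row B)"
    using assms(2) by (auto simp: invertible_mat_def inverts_mat_def)
  moreover have "dim_row B = n"
    using arg_cong[OF \<open>B * A = _\<close>, of dim_col] assms(1) by simp
  moreover have "dim_col B = n"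
    using arg_cong[OF \<open>A * B = _\<close>, of dim_col] assms(1) by simp
  ultimately have "A \<in> Units (ring_mat TYPE(real) n ())"
    using assms(1) by (auto simp: Units_def ring_mat_def intro!: bexI[of _ B])
  then obtain C where "mat_inverse A = Some C"
    using mat_inverse(1)[OF assms(1), where b = "()"] by (cases "mat_inverse A") auto
  then show "minv A \<in> carrier_mat n n" and "minv A * A = 1\<^sub>m n"
    using mat_inverse(2)[OF assms(1)] by (auto simp: minv_def)
qed

text \<open>
  The error of an approximate solution is the inverse applied to its residual:
  \<open>A\<inverse>f - u = A\<inverse>(f - A u)\<close>.
\<close>

lemma error_le_residual:
  assumes A: "A \<in> carrier_mat n n" "invertible_mat A"
    and f: "f \<in> carrier_vec n" and u: "u \<in> carrier_vec n"
  shows "vnorm (minv A *\<^sub>v f - u) \<le> opnorm (minv A) * vnorm (residual A f u)"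
proof -
  note M = minv_properties[OF A]
  have "minv A *\<^sub>v residual A f u = minv A *\<^sub>v f - minv A *\<^sub>v (A *\<^sub>v u)"
    unfolding residual_def using A M f u by (intro mult_minus_distrib_mat_vec) auto
  also have "minv A *\<^sub>v (A *\<^sub>v u) = u"
    using A M u by (simp add: assoc_mult_mat_vec[symmetric])
  finally have "minv A *\<^sub>v f - u = minv A *\<^sub>v residual A f u" ..
  then show ?thesis
    using vnorm_mult_mat_vec_le[of "residual A f u" "minv A"] A M f u
    by (simp add: residual_def)
qed

lemma is_rom_solution_carrier:
  assumes "is_rom_solution A f V ubar u"
    and "V \<in> carrier_mat n r" and "ubar \<in> carrier_vec n"
  shows "u \<in> carrier_vec n"
  using assms by (auto simp: is_rom_solution_def)

section \<open>Argument tuples and chains\<close>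

text \<open>
  Separate Lipschitz bounds add up: moving from \<open>\<nu>\<close> to \<open>\<mu>\<close> one entry at a time, through the
  tuples that agree with \<open>\<mu>\<close> below \<open>l\<close> and with \<open>\<nu>\<close> from \<open>l\<close> on, each step changes one
  argument only.
\<close>

lemma lipschitz_in_args:
  assumes lip: "\<And>l. l < m \<Longrightarrow> lipschitz_in_arg N m l (c l) f"
    and f: "\<And>\<mu>. \<mu> \<in> tuples N m \<Longrightarrow> f \<mu> \<in> carrier_vec d"
    and \<mu>: "\<mu> \<in> tuples N m" and \<nu>: "\<nu> \<in> tuples N m"
  shows "vnorm (f \<mu> - f \<nu>) \<le> (\<Sum>l<m. c l * vnorm (\<mu> ! l - \<nu> ! l))"
proof -
  define h where "h l = take l \<mu> @ drop l \<nu>" for l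
  have len: "length \<mu> = m" "length \<nu> = m"
    using \<mu> \<nu> by (auto simp: tuples_def)
  have h_in: "h l \<in> tuples N m" if "l \<le> m" for l
    using \<mu> \<nu> that by (auto simp: tuples_def h_def nth_append)
  have "vnorm (f (h l) - f \<nu>) \<le> (\<Sum>i<l. c i * vnorm (\<mu> ! i - \<nu> ! i))" if "l \<le> m" for l
    using that
  proof (induction l)
    case 0
    then show ?case
      using f[OF \<nu>] by (simp add: h_def)
  next
    case (Suc l)
    have step: "h (Suc l) = (h l)[l := \<mu> ! l]" and old: "h l ! l = \<nu> ! l"
      using Suc.prems len
      by (auto simp: h_def nth_append list_update_append take_Suc_conv_app_nth
          Cons_nth_drop_Suc[symmetric])
    have "vnorm (f (h (Suc l)) - f \<nu>)
        \<le> vnorm (f (h (Suc l)) - f (h l)) + vnorm (f (h l) - f \<nu>)"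
      using Suc.prems h_in \<nu> by (intro vnorm_diff_triangle[of _ d] f) auto
    moreover have "vnorm (f (h (Suc l)) - f (h l)) \<le> c l * vnorm (\<mu> ! l - \<nu> ! l)"
      using lip[of l] Suc.prems h_in[of l] \<mu> unfolding step old[symmetric]
      by (auto simp: lipschitz_in_arg_def tuples_def)
    ultimately show ?case
      using Suc.IH Suc.prems by simp
  qed
  from this[of m] show ?thesis
    using len by (simp add: h_def)
qed

lemma length_chain [simp]: "length (chain S x i) = Suc i"
  by (induction i) auto

lemma chain_nth_stable:
  assumes "l \<le> i"
  shows "chain S x i ! l = chain S x l ! l"
  using assms by (induction i) (auto simp: nth_append le_Suc_eq)

lemma chain_nth_Suc: "chain S x (Suc i) ! Suc i = S (Suc i) (chain S x i)"
  by (simp add: nth_append)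

text \<open>
  The values of \<open>S\<close> are constrained only along the chain itself, because a reduced-order
  solution is known to exist only at the data that actually occur.
\<close>

lemma chain_in_tuples:
  assumes "x \<in> carrier_vec (N 0)"
    and "\<And>j. j < i \<Longrightarrow> chain S x j \<in> tuples N (Suc j)
           \<Longrightarrow> S (Suc j) (chain S x j) \<in> carrier_vec (N (Suc j))"
  shows "chain S x i \<in> tuples N (Suc i)"
  using assms
proof (induction i)
  case 0
  then show ?case by (simp add: tuples_def)
next
  case (Suc i)
  then have "chain S x i \<in> tuples N (Suc i)" by simp
  moreover from this have "S (Suc i) (chain S x i) \<in> carrier_vec (N (Suc i))"
    using Suc.prems(2) by simp
  ultimately show ?case
    by (auto simp: tuples_def nth_append less_Suc_eq)
qed

section \<open>Path weights and propagation of errors\<close>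

text \<open>
  The factor by which an error made in system \<open>i\<close> reaches system \<open>j\<close>, summed over all routes
  through intermediate systems.
\<close>

definition path_weight :: "(nat \<Rightarrow> nat \<Rightarrow> real) \<Rightarrow> nat \<Rightarrow> nat \<Rightarrow> real" where
  "path_weight K i j = (\<Sum>\<sigma>\<in>dec_seqs i j. \<Prod>m<length \<sigma> - 1. K (\<sigma> ! m) (\<sigma> ! Suc m))"

lemma dec_seqs_rec:
  "dec_seqs i j = (if i = j then {[j]} else {}) \<union> (\<Union>l<j. (#) j ` dec_seqs i l)"
    (is "_ = ?R")
proof (rule Set.set_eqI)
  fix \<sigma>
  show "\<sigma> \<in> dec_seqs i j \<longleftrightarrow> \<sigma> \<in> ?R"
  proof (cases \<sigma>)
    case Nil
    then show ?thesis by (auto simp: dec_seqs_def)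
  next
    case (Cons s \<tau>)
    show ?thesis
    proof (cases \<tau>)
      case Nil
      then show ?thesis
        using Cons by (auto simp: dec_seqs_def)
    next
      case (Cons t \<rho>)
      then show ?thesis
        using \<open>\<sigma> = s # \<tau>\<close> by (auto simp: dec_seqs_def image_iff)
    qed
  qed
qed

lemma finite_dec_seqs [simp]: "finite (dec_seqs i j)"
proof (induction j rule: less_induct)
  case (less j)
  then show ?case
    by (subst dec_seqs_rec) auto
qed

text \<open>
  Removing the first term \<open>j\<close> of a sequence whose second term is \<open>l\<close> splits off the factor
  \<open>K j l\<close>.  In matrix form this is the resolvent identity \<open>W = 1 + K W\<close> for the strictly lower
  triangular part of \<open>K\<close>, where \<open>path_weight K i j\<close> is the entry of \<open>W\<close> in row \<open>j\<close> and
  column \<open>i\<close>.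
\<close>

lemma path_weight_rec:
  "path_weight K i j = (if i = j then 1 else 0) + (\<Sum>l<j. K j l * path_weight K i l)"
proof -
  define g where "g \<sigma> = (\<Prod>m<length \<sigma> - 1. K (\<sigma> ! m) (\<sigma> ! Suc m))" for \<sigma>
  have weight_g: "path_weight K i l = (\<Sum>\<sigma>\<in>dec_seqs i l. g \<sigma>)" for l
    by (simp add: path_weight_def g_def)
  have g_Cons: "g (j # \<sigma>) = K j l * g \<sigma>" if "\<sigma> \<in> dec_seqs i l" for \<sigma> l
  proof -
    from that obtain \<tau> where "\<sigma> = l # \<tau>"
      by (cases \<sigma>) (auto simp: dec_seqs_def)
    then show ?thesis
      by (simp add: g_def prod.lessThan_Suc_shift del: prod.lessThan_Suc)
  qed
  have single: "(\<Sum>\<sigma>\<in>(if i = j then {[j]} else {}). g \<sigma>) = (if i = j then 1 else 0)"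
    by (simp add: g_def)
  have "(\<Sum>\<sigma>\<in>(\<Union>l<j. (#) j ` dec_seqs i l). g \<sigma>) = (\<Sum>l<j. \<Sum>\<sigma>\<in>(#) j ` dec_seqs i l. g \<sigma>)"
    by (intro sum.UNION_disjoint ballI impI finite_imageI finite_dec_seqs finite_lessThan)
      (auto simp: dec_seqs_def)
  also have "\<dots> = (\<Sum>l<j. K j l * path_weight K i l)"
    by (simp add: sum.reindex g_Cons weight_g sum_distrib_left)
  finally have longer:
    "(\<Sum>\<sigma>\<in>(\<Union>l<j. (#) j ` dec_seqs i l). g \<sigma>) = (\<Sum>l<j. K j l * path_weight K i l)" .
  \<comment> \<open>the sequences of the second kind have at least two terms\<close>
  have disjoint: "(if i = j then {[j]} else {}) \<inter> (\<Union>l<j. (#) j ` dec_seqs i l) = {}"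
    by (auto simp: dec_seqs_def)
  have "path_weight K i j = (\<Sum>\<sigma>\<in>dec_seqs i j. g \<sigma>)"
    by (rule weight_g)
  also have "\<dots> = (\<Sum>\<sigma>\<in>(if i = j then {[j]} else {}). g \<sigma>)
      + (\<Sum>\<sigma>\<in>(\<Union>l<j. (#) j ` dec_seqs i l). g \<sigma>)"
    by (subst dec_seqs_rec, rule sum.union_disjoint) (simp_all only: disjoint, auto)
  finally show ?thesis
    by (simp only: single longer)
qed

lemma path_weight_eq_0: "j < i \<Longrightarrow> path_weight K i j = 0"
proof (induction j rule: less_induct)
  case (less j)
  then show ?case
    by (subst path_weight_rec) simp
qed

lemma path_weight_self: "path_weight K i i = 1"
  by (subst path_weight_rec) (simp add: path_weight_eq_0)

text \<open>
  A discrete Gronwall inequality.  Monotonicity of the recursion in earlier errors needs the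
  constants to be nonnegative; the path weights then solve the recursion with equality.
\<close>

lemma error_propagation:
  fixes e a :: "nat \<Rightarrow> real"
  assumes K: "\<And>j l. j \<le> p \<Longrightarrow> l < j \<Longrightarrow> 0 \<le> K j l"
    and e: "\<And>j. j \<le> p \<Longrightarrow> e j \<le> a j + (\<Sum>l<j. K j l * e l)"
    and "j \<le> p"
  shows "e j \<le> (\<Sum>i\<le>p. path_weight K i j * a i)"
  using \<open>j \<le> p\<close>
proof (induction j rule: less_induct)
  case (less j)
  have "e j \<le> a j + (\<Sum>l<j. K j l * e l)"
    using e less.prems .
  also have "\<dots> \<le> a j + (\<Sum>l<j. K j l * (\<Sum>i\<le>p. path_weight K i l * a i))"
    using less by (intro add_left_mono sum_mono mult_left_mono K) auto
  also have "(\<Sum>l<j. K j l * (\<Sum>i\<le>p. path_weight K i l * a i))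
      = (\<Sum>i\<le>p. (\<Sum>l<j. K j l * path_weight K i l) * a i)"
    unfolding sum_distrib_left sum_distrib_right
    by (subst sum.swap) (simp add: mult.assoc)
  also have "a j = (\<Sum>i\<le>p. (if i = j then 1 else 0) * a i)"
    using less.prems by (simp add: if_distrib[of "\<lambda>c. c * _"] cong: if_cong)
  also have "\<dots> + (\<Sum>i\<le>p. (\<Sum>l<j. K j l * path_weight K i l) * a i)
      = (\<Sum>i\<le>p. path_weight K i j * a i)"
    by (subst path_weight_rec) (simp add: sum.distrib distrib_right)
  finally show ?case .
qed

lemma sum_path_weight:
  assumes "i \<le> p"
  shows "(\<Sum>j\<le>p. L j * path_weight K i j) = L i + (\<Sum>j = i+1..p. L j * path_weight K i j)"
proof -
  have "(\<Sum>j\<le>p. L j * path_weight K i j) = (\<Sum>j = i..p. L j * path_weight K i j)"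
    by (rule sum.mono_neutral_right) (auto simp: path_weight_eq_0)
  also have "\<dots> = L i + (\<Sum>j = i+1..p. L j * path_weight K i j)"
    using assms by (simp add: sum.atLeast_Suc_atMost path_weight_self)
  finally show ?thesis .
qed

section \<open>The error bound\<close>

theorem corollary3p3:
  fixes p k :: nat
    and N :: "nat \<Rightarrow> nat"
    and \<phi> :: "real vec list \<Rightarrow> real vec"
    and A :: "nat \<Rightarrow> real vec list \<Rightarrow> real mat"
    and F :: "nat \<Rightarrow> real vec list \<Rightarrow> real vec"
    and L :: "nat \<Rightarrow> real"
    and K :: "nat \<Rightarrow> nat \<Rightarrow> real"
    and I :: "nat set"
    and X :: "nat \<Rightarrow> real vec"
    and P :: "nat \<Rightarrow> nat \<Rightarrow> nat"
    and V :: "nat \<Rightarrow> nat \<Rightarrow> real mat"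
    and ubar :: "nat \<Rightarrow> nat \<Rightarrow> real vec"
    and uhat :: "nat \<Rightarrow> nat \<Rightarrow> real vec list \<Rightarrow> real vec"
  assumes "1 \<le> p"
    and "\<And>i \<mu>. i \<in> {1..p} \<Longrightarrow> \<mu> \<in> tuples N i \<Longrightarrow>
           A i \<mu> \<in> carrier_mat (N i) (N i) \<and> invertible_mat (A i \<mu>)"
    and "\<And>i \<mu>. i \<in> {1..p} \<Longrightarrow> \<mu> \<in> tuples N i \<Longrightarrow> F i \<mu> \<in> carrier_vec (N i)"
    and "\<And>\<mu>. \<mu> \<in> tuples N (Suc p) \<Longrightarrow> \<phi> \<mu> \<in> carrier_vec (N 0)"
    and "\<And>j. j \<le> p \<Longrightarrow> lipschitz_in_arg N (Suc p) j (L j) \<phi>"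
    and "\<And>j l. j \<in> {1..p} \<Longrightarrow> l < j \<Longrightarrow> lipschitz_in_arg N j l (K j l) (solution_map A F j)"
    and "I \<subseteq> {1..p}"
    and "1 \<le> k"
    and "X (k - 1) \<in> carrier_vec (N 0)"
    and "\<And>i. i \<in> I \<Longrightarrow> V k i \<in> carrier_mat (N i) (P k i)"
    and "\<And>i. i \<in> I \<Longrightarrow> ubar k i \<in> carrier_vec (N i)"
    and "\<And>i \<mu>. i \<in> I \<Longrightarrow> \<mu> = inexact_data A F I (uhat k) (X (k - 1)) i \<Longrightarrow>
           is_rom_solution (A i \<mu>) (F i \<mu>) (V k i) (ubar k i) (uhat k i \<mu>)"
  shows "vnorm (exact_op \<phi> p A F (X (k - 1)) - inexact_op \<phi> p A F I (uhat k) (X (k - 1)))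
           \<le> (\<Sum>i\<in>I. delta p L K A F I (uhat k) (X (k - 1)) i)"
proof -
  define x where "x = X (k - 1)"
  define S where "S = solution_map A F"
  define T where "T = inexact_map A F I (uhat k)"
  define u where "u j = chain S x j" for j
  define w where "w j = chain T x j" for j
  define e where "e l = vnorm (u p ! l - w p ! l)" for l
  \<comment> \<open>the bound on the local error of system \<open>i\<close>, whose data are \<open>w (i - 1)\<close>\<close>
  define a where "a i = (if i \<in> I then opnorm (minv (A i (w (i - 1))))
      * vnorm (residual (A i (w (i - 1))) (F i (w (i - 1))) (uhat k i (w (i - 1)))) else 0)" for i
  have x: "x \<in> carrier_vec (N 0)"
    using assms(9) by (simp add: x_def)
  have S_in: "S j \<mu> \<in> carrier_vec (N j)" if "j \<in> {1..p}" "\<mu> \<in> tuples N j" for j \<mu>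
    using minv_properties(1)[of "A j \<mu>" "N j"] assms(2,3)[OF that]
    by (auto simp: S_def solution_map_def)
  have T_in: "T (Suc j) (w j) \<in> carrier_vec (N (Suc j))"
    if "j < p" "w j \<in> tuples N (Suc j)" for j
  proof (cases "Suc j \<in> I")
    case True
    have "w j = inexact_data A F I (uhat k) (X (k - 1)) (Suc j)"
      by (simp add: inexact_data_def w_def T_def x_def)
    from is_rom_solution_carrier[OF assms(12)[OF True this] assms(10)[OF True] assms(11)[OF True]]
    have "uhat k (Suc j) (w j) \<in> carrier_vec (N (Suc j))" .
    with True show ?thesis
      by (simp add: T_def inexact_map_def)
  next
    case False
    then show ?thesis
      using S_in[of "Suc j" "w j"] that by (simp add: T_def inexact_map_def S_def)
  qed
  have u: "u j \<in> tuples N (Suc j)" if "j \<le> p" for j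
    unfolding u_def using that x S_in by (intro chain_in_tuples) auto
  have w: "w j \<in> tuples N (Suc j)" if "j \<le> p" for j
    unfolding w_def using that x T_in by (intro chain_in_tuples) (auto simp: w_def)
  have e_eq: "e l = vnorm (u j ! l - w j ! l)" if "l \<le> j" "j \<le> p" for l j
    using that chain_nth_stable[of l j] chain_nth_stable[of l p]
    by (simp add: e_def u_def w_def)
  have local_error: "vnorm (S (Suc j) (w j) - T (Suc j) (w j)) \<le> a (Suc j)" if "j < p" for j
  proof (cases "Suc j \<in> I")
    case True
    have "Suc j \<in> {1..p}" and "w j \<in> tuples N (Suc j)"
      using that w by auto
    note dat = assms(2,3)[OF this]
    have "T (Suc j) (w j) = uhat k (Suc j) (w j)"
      using True by (simp add: T_def inexact_map_def)
    then show ?thesis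
      using error_le_residual[of "A (Suc j) (w j)" "N (Suc j)" "F (Suc j) (w j)"
          "T (Suc j) (w j)"] dat T_in[of j] w[of j] that True
      by (simp add: a_def S_def solution_map_def)
  next
    case False
    moreover have "T (Suc j) (w j) = S (Suc j) (w j)"
      using False by (simp add: T_def S_def inexact_map_def)
    moreover have "S (Suc j) (w j) \<in> carrier_vec (N (Suc j))"
      using that w by (intro S_in) auto
    ultimately show ?thesis
      by (simp add: a_def)
  qed
  \<comment> \<open>local plus propagated error, with the exact map at the inexact data in between\<close>
  have e_rec: "e j \<le> a j + (\<Sum>l<j. K j l * e l)" if "j \<le> p" for j
  proof (cases j)
    case 0
    \<comment> \<open>entry \<open>0\<close> of both chains is \<open>x\<close>, and no system has index \<open>0\<close>\<close>
    have "0 \<notin> I"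
      using assms(7) by auto
    then show ?thesis
      using 0 x e_eq[of 0 0] by (simp add: a_def u_def w_def)
  next
    case (Suc i)
    have i: "i < p" "Suc i \<in> {1..p}" and ui: "u i \<in> tuples N (Suc i)"
      and wi: "w i \<in> tuples N (Suc i)"
      using Suc that u w by auto
    have "e j = vnorm (S j (u i) - T j (w i))"
      using e_eq[of j j] that by (simp add: Suc u_def w_def chain_nth_Suc del: chain.simps(2))
    also have "\<dots> \<le> vnorm (S j (u i) - S j (w i)) + vnorm (S j (w i) - T j (w i))"
      using i ui wi S_in T_in unfolding Suc by (intro vnorm_diff_triangle[of _ "N (Suc i)"]) auto
    also have "vnorm (S j (u i) - S j (w i)) \<le> (\<Sum>l<j. K j l * vnorm (u i ! l - w i ! l))"
      using i ui wi S_in assms(6) unfolding Suc S_def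
      by (intro lipschitz_in_args[where N = N and d = "N (Suc i)"]) auto
    also have "\<dots> = (\<Sum>l<j. K j l * e l)"
      using i Suc by (intro sum.cong) (auto simp: e_eq[of _ i])
    also have "vnorm (S j (w i) - T j (w i)) \<le> a j"
      using local_error[of i] i Suc by simp
    finally show ?thesis
      by simp
  qed
  have "e j \<le> (\<Sum>i\<le>p. path_weight K i j * a i)" if "j \<le> p" for j
    using assms(6) e_rec that
    by (intro error_propagation) (auto simp: lipschitz_in_arg_def)
  moreover have "vnorm (\<phi> (u p) - \<phi> (w p)) \<le> (\<Sum>j<Suc p. L j * e j)"
    unfolding e_def using assms(4,5) u w
    by (intro lipschitz_in_args[where N = N and d = "N 0"]) auto
  moreover have "0 \<le> L j" if "j \<le> p" for j
    using assms(5)[OF that] by (simp add: lipschitz_in_arg_def)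
  ultimately have "vnorm (\<phi> (u p) - \<phi> (w p))
      \<le> (\<Sum>j\<le>p. L j * (\<Sum>i\<le>p. path_weight K i j * a i))"
    unfolding lessThan_Suc_atMost
    by (elim order.trans) (intro sum_mono mult_left_mono; simp)
  also have "\<dots> = (\<Sum>i\<le>p. (\<Sum>j\<le>p. L j * path_weight K i j) * a i)"
    unfolding sum_distrib_left sum_distrib_right
    by (subst sum.swap) (simp add: mult.assoc)
  also have "\<dots> = (\<Sum>i\<in>I. (\<Sum>j\<le>p. L j * path_weight K i j) * a i)"
    using assms(7) by (intro sum.mono_neutral_right) (auto simp: a_def)
  also have "\<dots> = (\<Sum>i\<in>I. delta p L K A F I (uhat k) x i)"
  proof (rule sum.cong[OF refl])
    fix i assume "i \<in> I"
    moreover from this have "i \<le> p"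
      using assms(7) by auto
    ultimately show "(\<Sum>j\<le>p. L j * path_weight K i j) * a i = delta p L K A F I (uhat k) x i"
      unfolding sum_path_weight[OF \<open>i \<le> p\<close>]
      by (simp add: path_weight_def delta_def a_def inexact_data_def w_def T_def Let_def mult.assoc)
  qed
  finally show ?thesis
    by (simp add: exact_op_def inexact_op_def composed_op_def u_def w_def S_def T_def x_def)
qed

end
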